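(* Let $\mathcal S$ be a set, $\bm F_{\Delta t}:\mathcal S\to\mathcal S$ a (possibly nonlinear) map, $\bm g:\mathcal S\to\mathbb F^m$ an observable, and let $\mathcal S_{\mathrm{ser}}$, $\bm F_{\mathrm{ser}}$, $g_{\mathrm{ser}}$, the serialized trajectory $\{\bm\sigma_\ell\}$, the delay observable $\bm h_q$, the vectors $\bm h_\ell$ and the matrices $\bm H,\bm H_0,\bm H_1$ be as defined in the context. Let $\mathcal G_{\mathrm{ser}}$ be a linear space of $\mathbb F$-valued functions (observables) on $\mathcal S_{\mathrm{ser}}$ that contains $g_{\mathrm{ser}}$ and is invariant under composition with $\bm F_{\mathrm{ser}}$, i.e. $g\in\mathcal G_{\mathrm{ser}}\Rightarrow g\circ\bm F_{\mathrm{ser}}\in\mathcal G_{\mathrm{ser}}$. Then: (1) The Koopman composition operator $\mathcal K_{\mathrm{ser}}:\mathcal G_{\mathrm{ser}}\to\mathcal G_{\mathrm{ser}}$, $(\mathcal K_{\mathrm{ser}}g)(\bm\sigma)=g(\bm F_{\mathrm{ser}}(\bm\sigma))$, is well defined and linear, even when $\bm F_{\Delta t}$ is nonlinear. (2) For $q\ge 1$ define $\mathscr D_q g=[\,g,\ \mathcal K_{\mathrm{ser}}g,\ \ldots,\ \mathcal K_{\mathrm{ser}}^{q-1}g\,]^{\mathsf T}\in(\mathcal G_{\mathrm{ser}})^q$, and let $\mathcal K_{\mathrm{ser}}^{(q)}$ denote the componentwise action of $\mathcal K_{\mathrm{ser}}$ on $(\mathcal G_{\mathrm{ser}})^q$.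 Then $$\mathcal K_{\mathrm{ser}}^{(q)}\mathscr D_q g=\mathscr D_q\mathcal K_{\mathrm{ser}}g,\qquad g\in\mathcal G_{\mathrm{ser}}.$$ (3) In particular $\bm h_q=\mathscr D_q g_{\mathrm{ser}}$, and along the serialized trajectory $$\bm h_\ell=\bm h_q(\bm\sigma_\ell),\qquad \bm h_{\ell+1}=\bigl(\mathcal K_{\mathrm{ser}}^{(q)}\bm h_q\bigr)(\bm\sigma_\ell),\qquad \ell=1,\ldots,K-1,$$ $$\bm H_0=\bigl[\bm h_q(\bm\sigma_1)\ \cdots\ \bm h_q(\bm\sigma_{K-1})\bigr],\qquad \bm H_1=\bigl[(\mathcal K_{\mathrm{ser}}^{(q)}\bm h_q)(\bm\sigma_1)\ \cdots\ (\mathcal K_{\mathrm{ser}}^{(q)}\bm h_q)(\bm\sigma_{K-1})\bigr].$$ (4) Let $\mathcal G_q^H=\operatorname{span}\{g_{\mathrm{ser}},\mathcal K_{\mathrm{ser}}g_{\mathrm{ser}},\ldots,\mathcal K_{\mathrm{ser}}^{q-1}g_{\mathrm{ser}}\}$. If $\mathcal G_q^H$ is invariant under $\mathcal K_{\mathrm{ser}}$, then there exists a matrix $\bm K_H\in\mathbb F^{q\times q}$ such that $$\mathcal K_{\mathrm{ser}}^{(q)}\bm h_q=\bm K_H\bm h_q,\qquad \bm h_{\ell+1}=\bm K_H\bm h_\ell\ \ (\ell=1,\ldots,K-1),\qquad \bm H_1=\bm K_H\bm H_0.$$ If the component observables of $\bm h_q$ are linearly independent, then $\bm K_H$ (the matrix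 with $\mathcal K_{\mathrm{ser}}^{(q)}\bm h_q=\bm K_H\bm h_q$) is unique. If they are linearly dependent, the representing matrix need not be unique; nevertheless every matrix $\bm K_H$ with $\mathcal K_{\mathrm{ser}}^{(q)}\bm h_q=\bm K_H\bm h_q$ induces the same Koopman action on $\mathcal G_q^H$ and the same sampled relations $\bm h_{\ell+1}=\bm K_H\bm h_\ell$, $\bm H_1=\bm K_H\bm H_0$.
   Context: $\mathbb F=\mathbb R$ or $\mathbb C$; $m,N\ge1$ are integers (number of channels and of sampling instants). The states satisfy $\bm s_{k+1}=\bm F_{\Delta t}(\bm s_k)$ for $k=1,\ldots,N-1$, with centered measurements $\bm x_k=\bm g(\bm s_k)\in\mathbb F^m$, $k=1,\dots,N$. Serialized record: $N_H=mN$ and $\bm x_H=[\bm x_1^{\mathsf T},\ldots,\bm x_N^{\mathsf T}]^{\mathsf T}=[x_{H,1},\ldots,x_{H,N_H}]^{\mathsf T}\in\mathbb F^{N_H}$. Delay depth $q\in\{1,\ldots,N_H-1\}$ and $K=N_H-q+1\ge2$. Delay vectors: $\bm h_\ell=[x_{H,\ell},x_{H,\ell+1},\ldots,x_{H,\ell+q-1}]^{\mathsf T}\in\mathbb F^q$, $\ell=1,\ldots,K$. Hankel matrix $\bm H=[\bm h_1\cdots\bm h_K]\in\mathbb F^{q\times K}$; shifted pair $\bm H_0=[\bm h_1\cdots\bm h_{K-1}]$, $\bm H_1=[\bm h_2\cdots\bm h_K]$, both in $\mathbb F^{q\times(K-1)}$. Augmented serialized state space: $\mathcal S_{\mathrm{ser}}=\mathcal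 S\times\{1,\ldots,m\}$. Serialized shift map: $\bm F_{\mathrm{ser}}(\bm s,i)=(\bm s,i+1)$ if $1\le i<m$, and $\bm F_{\mathrm{ser}}(\bm s,m)=(\bm F_{\Delta t}(\bm s),1)$. Serialized states: for $\ell=m(k-1)+i$ with $1\le k\le N$, $1\le i\le m$, $\bm\sigma_\ell=(\bm s_k,i)$. Scalar serialized observable: $g_{\mathrm{ser}}(\bm s,i)=\bm e_i^{\mathsf T}\bm g(\bm s)$ with $\bm e_i$ the $i$th canonical basis vector of $\mathbb F^m$, so that $x_{H,\ell}=g_{\mathrm{ser}}(\bm\sigma_\ell)$ and $\bm\sigma_{\ell+1}=\bm F_{\mathrm{ser}}(\bm\sigma_\ell)$. Delay observable $\bm h_q:\mathcal S_{\mathrm{ser}}\to\mathbb F^q$: $\bm h_q(\bm\sigma)=[g_{\mathrm{ser}}(\bm\sigma),\ g_{\mathrm{ser}}(\bm F_{\mathrm{ser}}(\bm\sigma)),\ldots,g_{\mathrm{ser}}(\bm F_{\mathrm{ser}}^{q-1}(\bm\sigma))]^{\mathsf T}$. *)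

theory Defs
  imports
    Complex_Main
    "HOL-Library.Function_Algebras"
    "Jordan_Normal_Form.Matrix"
begin

text \<open>
  Channel indices, time indices and delay-vector indices start at 1; entries of
  \<open>vec\<close> and \<open>mat\<close> are indexed from 0, so that the \<open>i\<close>-th channel of \<open>v\<close> is \<open>v $ (i - 1)\<close>.
  The definitions make sense over any field; the scalars ``real or complex'' are the instances of
  \<open>real_normed_field\<close>, whose norm is multiplicative, so that up to isomorphism there are no others.
\<close>

subsection \<open>Serialized dynamics\<close>

definition ser_states :: "'s set \<Rightarrow> nat \<Rightarrow> ('s \<times> nat) set" where
  "ser_states S m = S \<times> {1..m}"

definition ser_map :: "nat \<Rightarrow> ('s \<Rightarrow> 's) \<Rightarrow> 's \<times> nat \<Rightarrow> 's \<times> nat" where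
  "ser_map m F = (\<lambda>(s, i). if 1 \<le> i \<and> i < m then (s, i + 1) else (F s, 1))"

text \<open>For \<open>l = m * (k - 1) + i\<close> with \<open>1 \<le> i \<le> m\<close> the value at \<open>l\<close> is \<open>(s k, i)\<close>.\<close>

definition ser_traj :: "nat \<Rightarrow> (nat \<Rightarrow> 's) \<Rightarrow> nat \<Rightarrow> 's \<times> nat" where
  "ser_traj m s l = (s ((l - 1) div m + 1), (l - 1) mod m + 1)"

subsection \<open>Observables\<close>

text \<open>
  A scalar function on the set \<open>ser_states S m\<close> is represented by the total function that
  agrees with it on this set and is 0 elsewhere. Equality and the pointwise linear structure
  of such total functions are then those of functions on \<open>ser_states S m\<close>.
\<close>

definition on_ser :: "'s set \<Rightarrow> nat \<Rightarrow> ('s \<times> nat \<Rightarrow> 'f::zero) \<Rightarrow> 's \<times> nat \<Rightarrow> 'f" where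
  "on_ser S m f = (\<lambda>\<sigma>. if \<sigma> \<in> ser_states S m then f \<sigma> else 0)"

definition observables :: "'s set \<Rightarrow> nat \<Rightarrow> ('s \<times> nat \<Rightarrow> 'f::zero) set" where
  "observables S m = {f. \<forall>\<sigma>. \<sigma> \<notin> ser_states S m \<longrightarrow> f \<sigma> = 0}"

definition obs_scale :: "'f::field \<Rightarrow> ('x \<Rightarrow> 'f) \<Rightarrow> 'x \<Rightarrow> 'f" where
  "obs_scale c f = (\<lambda>x. c * f x)"

interpretation obs: vector_space "obs_scale :: 'f::field \<Rightarrow> ('x \<Rightarrow> 'f) \<Rightarrow> 'x \<Rightarrow> 'f"
  by unfold_locales (auto simp: obs_scale_def fun_eq_iff algebra_simps)

definition ser_obs :: "'s set \<Rightarrow> nat \<Rightarrow> ('s \<Rightarrow> 'f::zero vec) \<Rightarrow> 's \<times> nat \<Rightarrow> 'f" where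
  "ser_obs S m g = on_ser S m (\<lambda>(s, i). g s $ (i - 1))"

definition koopman ::
    "'s set \<Rightarrow> nat \<Rightarrow> ('s \<Rightarrow> 's) \<Rightarrow> ('s \<times> nat \<Rightarrow> 'f::zero) \<Rightarrow> 's \<times> nat \<Rightarrow> 'f" where
  "koopman S m F f = on_ser S m (\<lambda>\<sigma>. f (ser_map m F \<sigma>))"

subsection \<open>Tuples of observables\<close>

text \<open>
  Elements of the \<open>q\<close>-fold power of a space of observables are \<open>vec\<close>s whose entries are
  functions; \<open>components\<close> and \<open>eval_tuple\<close> convert between these and functions with
  values in the \<open>q\<close>-dimensional coordinate space.
\<close>

definition components ::
    "'s set \<Rightarrow> nat \<Rightarrow> nat \<Rightarrow> ('s \<times> nat \<Rightarrow> 'f::zero vec) \<Rightarrow> ('s \<times> nat \<Rightarrow> 'f) vec" where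
  "components S m q h = vec q (\<lambda>j. on_ser S m (\<lambda>\<sigma>. h \<sigma> $ j))"

definition eval_tuple :: "('x \<Rightarrow> 'f) vec \<Rightarrow> 'x \<Rightarrow> 'f vec" where
  "eval_tuple V \<sigma> = map_vec (\<lambda>f. f \<sigma>) V"

definition koopman_tuple ::
    "'s set \<Rightarrow> nat \<Rightarrow> ('s \<Rightarrow> 's) \<Rightarrow> ('s \<times> nat \<Rightarrow> 'f::zero) vec \<Rightarrow> ('s \<times> nat \<Rightarrow> 'f) vec" where
  "koopman_tuple S m F V = map_vec (koopman S m F) V"

definition delay_lift ::
    "'s set \<Rightarrow> nat \<Rightarrow> ('s \<Rightarrow> 's) \<Rightarrow> nat \<Rightarrow> ('s \<times> nat \<Rightarrow> 'f::zero) \<Rightarrow> ('s \<times> nat \<Rightarrow> 'f) vec" where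
  "delay_lift S m F q f = vec q (\<lambda>j. (koopman S m F ^^ j) f)"

definition delay_obs ::
    "'s set \<Rightarrow> nat \<Rightarrow> ('s \<Rightarrow> 's) \<Rightarrow> ('s \<Rightarrow> 'f::zero vec) \<Rightarrow> nat \<Rightarrow> 's \<times> nat \<Rightarrow> 'f vec" where
  "delay_obs S m F g q \<sigma> = vec q (\<lambda>j. ser_obs S m g ((ser_map m F ^^ j) \<sigma>))"

text \<open>The \<open>q\<close>-tuple valued function obtained by applying the Koopman operator to each component
  of the delay observable.\<close>

definition koopman_delay_obs ::
    "'s set \<Rightarrow> nat \<Rightarrow> ('s \<Rightarrow> 's) \<Rightarrow> ('s \<Rightarrow> 'f::zero vec) \<Rightarrow> nat \<Rightarrow> 's \<times> nat \<Rightarrow> 'f vec" where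
  "koopman_delay_obs S m F g q =
     eval_tuple (koopman_tuple S m F (components S m q (delay_obs S m F g q)))"

text \<open>Linear independence of a tuple as a family: a repeated entry makes it dependent.\<close>

definition lin_indep_tuple :: "('x \<Rightarrow> 'f::field) vec \<Rightarrow> bool" where
  "lin_indep_tuple V \<longleftrightarrow>
     inj_on (\<lambda>j. V $ j) {..<dim_vec V} \<and> obs.independent ((\<lambda>j. V $ j) ` {..<dim_vec V})"

definition delay_space ::
    "'s set \<Rightarrow> nat \<Rightarrow> ('s \<Rightarrow> 's) \<Rightarrow> ('s \<Rightarrow> 'f::field vec) \<Rightarrow> nat \<Rightarrow> ('s \<times> nat \<Rightarrow> 'f) set" where
  "delay_space S m F g q = obs.span ((\<lambda>j. (koopman S m F ^^ j) (ser_obs S m g)) ` {..<q})"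

subsection \<open>Representing matrices\<close>

definition represents ::
    "'s set \<Rightarrow> nat \<Rightarrow> ('s \<Rightarrow> 's) \<Rightarrow> ('s \<Rightarrow> 'f::field vec) \<Rightarrow> nat \<Rightarrow> 'f mat \<Rightarrow> bool" where
  "represents S m F g q A \<longleftrightarrow> A \<in> carrier_mat q q \<and>
     (\<forall>\<sigma> \<in> ser_states S m. koopman_delay_obs S m F g q \<sigma> = A *\<^sub>v delay_obs S m F g q \<sigma>)"

text \<open>
  The action of a matrix \<open>A\<close> on the span of the components of the delay observable \<open>h\<close> sends
  \<open>c\<^sup>T h\<close> to \<open>c\<^sup>T A h\<close>. The coefficients \<open>c\<close> need not be determined by \<open>c\<^sup>T h\<close>, so
  it is a relation in general.
\<close>

definition induced_action ::
    "'s set \<Rightarrow> nat \<Rightarrow> ('s \<Rightarrow> 's) \<Rightarrow> ('s \<Rightarrow> 'f::field vec) \<Rightarrow> nat \<Rightarrow> 'f mat \<Rightarrow>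
      (('s \<times> nat \<Rightarrow> 'f) \<times> ('s \<times> nat \<Rightarrow> 'f)) set" where
  "induced_action S m F g q A =
     {(on_ser S m (\<lambda>\<sigma>. c \<bullet> delay_obs S m F g q \<sigma>),
       on_ser S m (\<lambda>\<sigma>. c \<bullet> (A *\<^sub>v delay_obs S m F g q \<sigma>))) | c. c \<in> carrier_vec q}"

subsection \<open>Serialized data\<close>

definition ser_record :: "nat \<Rightarrow> (nat \<Rightarrow> 'f vec) \<Rightarrow> 'f vec" where
  "ser_record N x = vec_of_list (concat (map (\<lambda>k. list_of_vec (x k)) [1..<Suc N]))"

definition delay_vec :: "nat \<Rightarrow> (nat \<Rightarrow> 'f vec) \<Rightarrow> nat \<Rightarrow> nat \<Rightarrow> 'f vec" where
  "delay_vec N x q l = vec q (\<lambda>j. ser_record N x $ (l + j - 1))"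

text \<open>
  Columns \<open>a, \<dots>, b\<close> of the Hankel matrix: with \<open>K\<close> delay vectors, the full matrix is
  the case \<open>a = 1, b = K\<close>, and the shifted pair is \<open>a = 1, b = K - 1\<close> and \<open>a = 2, b = K\<close>.
\<close>

definition hankel_cols :: "nat \<Rightarrow> (nat \<Rightarrow> 'f vec) \<Rightarrow> nat \<Rightarrow> nat \<Rightarrow> nat \<Rightarrow> 'f mat" where
  "hankel_cols N x q a b = mat_of_cols q (map (delay_vec N x q) [a..<Suc b])"

end

theory Submission
  imports Defs
begin

text \<open>
  On serialized states the \<open>j\<close>-th power of the Koopman operator is composition with the \<open>j\<close>-th
  iterate of the serialized shift map. Hence the components of the delay observable are the Koopman
  iterates of the scalar observable, and a matrix represents the Koopman action exactly when its
  \<open>i\<close>-th row expresses the \<open>(i + 1)\<close>-st iterate through the first \<open>q\<close> of them, counting from 0.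
  Existence and uniqueness of representing matrices thus become statements about spanning and
  linear independence, applied row by row; the sampled relations follow by evaluation at the states
  of the trajectory.
\<close>

section \<open>Finite families in vector spaces\<close>

context vector_space
begin

text \<open>Coefficients are indexed by \<open>I\<close> rather than by vectors, so \<open>e\<close>
  may repeat values, as Koopman iterates can. The combinations form a subspace containing every
  \<open>e i\<close>, hence contain the span.\<close>

lemma span_image_finite:
  assumes "finite I"
  shows "span (e ` I) = {\<Sum>i\<in>I. c i *s e i | c. True}" (is "_ = ?T")
proof
  have "subspace ?T"
  proof (rule subspaceI)
    show "0 \<in> ?T" by (auto intro!: exI[of _ "\<lambda>_. 0"])
  next
    fix u v assume "u \<in> ?T" "v \<in> ?T"
    then obtain c d where "u = (\<Sum>i\<in>I. c i *s e i)" "v = (\<Sum>i\<in>I. d i *s e i)" by auto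
    then have "u + v = (\<Sum>i\<in>I. (c i + d i) *s e i)"
      by (simp add: scale_left_distrib sum.distrib)
    then show "u + v \<in> ?T" by auto
  next
    fix a u assume "u \<in> ?T"
    then obtain c where "u = (\<Sum>i\<in>I. c i *s e i)" by auto
    then have "a *s u = (\<Sum>i\<in>I. (a * c i) *s e i)"
      by (simp add: scale_sum_right)
    then show "a *s u \<in> ?T" by auto
  qed
  moreover have "e ` I \<subseteq> ?T"
  proof
    fix v assume "v \<in> e ` I"
    then obtain k where k: "k \<in> I" "v = e k" by auto
    have "(\<Sum>i\<in>I. (if i = k then 1 else 0) *s e i) = (\<Sum>i\<in>I. if i = k then e i else 0)"
      by (rule sum.cong) auto
    then have "v = (\<Sum>i\<in>I. (if i = k then 1 else 0) *s e i)"
      using k assms by simp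
    then show "v \<in> ?T"
      by (intro CollectI exI[of _ "\<lambda>i. if i = k then 1 else 0"] conjI TrueI)
  qed
  ultimately show "span (e ` I) \<subseteq> ?T" by (rule span_minimal[rotated])
next
  show "?T \<subseteq> span (e ` I)" by (auto intro: span_sum span_scale span_base)
qed

text \<open>Injectivity lets a relation over indices be read as one over distinct vectors.
  Conversely, a repeated vector would give a nontrivial relation with coefficients 1 and -1.\<close>

lemma independent_family_iff:
  assumes "finite I"
  shows "inj_on e I \<and> independent (e ` I) \<longleftrightarrow>
    (\<forall>c. (\<Sum>i\<in>I. c i *s e i) = 0 \<longrightarrow> (\<forall>i\<in>I. c i = 0))" (is "?L \<longleftrightarrow> ?R")
proof
  assume L: ?L
  show ?R
  proof (intro allI impI ballI)
    fix c i assume 0: "(\<Sum>i\<in>I. c i *s e i) = 0" and i: "i \<in> I"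
    \<comment> \<open>Coefficients are carried over from indices to vectors; \<open>inv_into\<close>
      recovers the index because \<open>e\<close> is injective on \<open>I\<close>.\<close>
    let ?u = "\<lambda>v. c (inv_into I e v)"
    have "(\<Sum>v\<in>e ` I. ?u v *s v) = (\<Sum>i\<in>I. c i *s e i)"
      using L by (simp add: sum.reindex)
    with 0 have "(\<Sum>v\<in>e ` I. ?u v *s v) = 0" by simp
    then have "?u (e i) = 0"
      using L i assms independent_explicit_module[THEN iffD1, rule_format, of "e ` I" "e ` I" ?u "e i"]
      by blast
    then show "c i = 0" using L i by simp
  qed
next
  assume R: ?R
  have inj: "inj_on e I"
  proof (rule inj_onI, rule ccontr)
    fix j k assume jk: "j \<in> I" "k \<in> I" "e j = e k" "j \<noteq> k"
    let ?c = "\<lambda>i. if i = j then 1 else if i = k then -1 else 0"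
    have "(\<Sum>i\<in>I. ?c i *s e i) = (\<Sum>i\<in>I. (if i = j then e i else 0) + (if i = k then - e i else 0))"
      using jk by (intro sum.cong) auto
    also have "\<dots> = 0" using jk assms by (simp add: sum.distrib)
    finally show False using R[rule_format, of ?c j] jk(1) by simp
  qed
  moreover have "independent (e ` I)"
  proof (rule independent_if_scalars_zero)
    fix u v assume 0: "(\<Sum>v\<in>e ` I. u v *s v) = 0" and v: "v \<in> e ` I"
    have "(\<Sum>i\<in>I. u (e i) *s e i) = 0" using 0 inj by (simp add: sum.reindex)
    then show "u v = 0" using R v by auto
  qed (use assms in simp)
  ultimately show ?L by simp
qed

end

lemma sum_obs_scale_apply:
  "(\<Sum>i\<in>I. obs_scale (c i) (e i)) y = (\<Sum>i\<in>I. c i * e i y)"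
  by (induction I rule: infinite_finite_induct) (auto simp: obs_scale_def)

section \<open>Lists and matrices\<close>

text \<open>Dropping the first block lowers \<open>k\<close> by \<open>n\<close>, hence
  \<open>k div n\<close> by one, and keeps \<open>k mod n\<close>. In the serialized record,
  quotient and remainder are the time instant and the channel, both counted from 0.\<close>

lemma nth_concat_uniform:
  assumes "\<And>ys. ys \<in> set yss \<Longrightarrow> length ys = n" and "k < n * length yss"
  shows "concat yss ! k = yss ! (k div n) ! (k mod n)"
  using assms
proof (induction yss arbitrary: k)
  case (Cons ys yss)
  then have n: "n > 0" "length ys = n" by (auto intro: gr0I)
  show ?case
  proof (cases "k < n")
    case False
    then obtain d where d: "k = n + d" using le_Suc_ex[of n k] by auto
    then have "concat yss ! d = yss ! (d div n) ! (d mod n)"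
      using Cons by auto
    then show ?thesis using d n by (simp add: nth_append)
  qed (use n in \<open>simp add: nth_append\<close>)
qed simp

text \<open>Collects the sampled relations, one per column, into a single matrix identity.\<close>

lemma mult_mat_of_cols:
  assumes "A \<in> carrier_mat n q" and "set vs \<subseteq> carrier_vec q"
  shows "A * mat_of_cols q vs = mat_of_cols n (map ((*\<^sub>v) A) vs)"
proof (rule eq_matI)
  fix i j assume "i < dim_row (mat_of_cols n (map ((*\<^sub>v) A) vs))"
    "j < dim_col (mat_of_cols n (map ((*\<^sub>v) A) vs))"
  moreover from this have "vs ! j \<in> carrier_vec q" using assms(2) by (auto simp: subset_iff)
  ultimately show "(A * mat_of_cols q vs) $$ (i, j) = mat_of_cols n (map ((*\<^sub>v) A) vs) $$ (i, j)"
    using assms by (simp add: mat_of_cols_index)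
qed (use assms in auto)

section \<open>Serialized dynamics and the Koopman operator\<close>

lemma ser_map_mem:
  assumes "F \<in> S \<rightarrow> S" and "\<sigma> \<in> ser_states S m"
  shows "ser_map m F \<sigma> \<in> ser_states S m"
  using assms by (auto simp: ser_map_def ser_states_def split: prod.splits)

lemma ser_map_funpow_mem:
  assumes "F \<in> S \<rightarrow> S" and "\<sigma> \<in> ser_states S m"
  shows "(ser_map m F ^^ j) \<sigma> \<in> ser_states S m"
  by (induction j) (use assms in \<open>auto intro: ser_map_mem\<close>)

lemma koopman_apply:
  "koopman S m F f \<sigma> = (if \<sigma> \<in> ser_states S m then f (ser_map m F \<sigma>) else 0)"
  by (simp add: koopman_def on_ser_def)

text \<open>\<open>koopman\<close> returns 0 off the serialized states, so the orbit of
  \<open>\<sigma>\<close> has to stay among them; this is where \<open>F\<close> mapping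
  \<open>S\<close> into itself enters.\<close>

lemma koopman_funpow_apply:
  assumes "F \<in> S \<rightarrow> S" and "\<sigma> \<in> ser_states S m"
  shows "(koopman S m F ^^ j) f \<sigma> = f ((ser_map m F ^^ j) \<sigma>)"
  using assms(2)
proof (induction j arbitrary: \<sigma>)
  case (Suc j)
  then show ?case
    using ser_map_mem[OF assms(1) Suc.prems] by (simp add: koopman_apply funpow_swap1)
qed simp

text \<open>For \<open>j = 0\<close> this is the convention for observables; positive powers vanish
  by definition of \<open>koopman\<close>. It upgrades identities on serialized states to equalities
  of total functions.\<close>

lemma koopman_funpow_outside:
  assumes "f \<in> observables S m" and "\<sigma> \<notin> ser_states S m"
  shows "(koopman S m F ^^ j) f \<sigma> = 0"
  using assms by (cases j) (simp_all add: koopman_apply observables_def del: split_paired_All)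

lemma koopman_add: "koopman S m F (f + f') = koopman S m F f + (koopman S m F f' :: _ \<Rightarrow> 'f::field)"
  by (auto simp: koopman_apply fun_eq_iff)

lemma koopman_scale: "koopman S m F (obs_scale c f) = obs_scale c (koopman S m F f)"
  by (auto simp: koopman_apply obs_scale_def fun_eq_iff)

text \<open>The operator commutes with its own powers.\<close>

lemma koopman_tuple_delay_lift:
  "koopman_tuple S m F (delay_lift S m F p f) = delay_lift S m F p (koopman S m F f)"
  by (auto simp: koopman_tuple_def delay_lift_def funpow_swap1)

lemma ser_obs_observable: "ser_obs S m g \<in> observables S m"
  by (simp add: ser_obs_def on_ser_def observables_def)

lemma dim_delay_obs [simp]: "dim_vec (delay_obs S m F g q \<sigma>) = q"
  by (simp add: delay_obs_def)

lemma delay_obs_nth: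
  assumes "F \<in> S \<rightarrow> S" and "\<sigma> \<in> ser_states S m" and "j < q"
  shows "delay_obs S m F g q \<sigma> $ j = (koopman S m F ^^ j) (ser_obs S m g) \<sigma>"
  using assms by (simp add: delay_obs_def koopman_funpow_apply)

lemma components_delay_obs:
  assumes "F \<in> S \<rightarrow> S"
  shows "components S m q (delay_obs S m F g q) = delay_lift S m F q (ser_obs S m g)"
  using assms
  by (auto simp: components_def delay_lift_def on_ser_def fun_eq_iff delay_obs_nth
      koopman_funpow_outside[OF ser_obs_observable])

lemma koopman_delay_obs_eq:
  assumes "F \<in> S \<rightarrow> S"
  shows "koopman_delay_obs S m F g q \<sigma> = vec q (\<lambda>j. (koopman S m F ^^ Suc j) (ser_obs S m g) \<sigma>)"
  by (auto simp: koopman_delay_obs_def components_delay_obs[OF assms] koopman_tuple_def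
      delay_lift_def eval_tuple_def)

text \<open>Entry \<open>j\<close> of either side is the scalar observable after
  \<open>Suc j\<close> shifts. This turns the Koopman action into a shift along the
  trajectory.\<close>

lemma koopman_delay_obs_eq_delay_obs:
  assumes "F \<in> S \<rightarrow> S" and "\<sigma> \<in> ser_states S m"
  shows "koopman_delay_obs S m F g q \<sigma> = delay_obs S m F g q (ser_map m F \<sigma>)"
  using assms
  by (auto simp: koopman_delay_obs_eq koopman_apply delay_obs_nth ser_map_mem delay_obs_def
      koopman_funpow_apply)

section \<open>Representing matrices\<close>

lemma delay_space_eq:
  "delay_space S m F g q =
    {\<Sum>j<q. obs_scale (c j) ((koopman S m F ^^ j) (ser_obs S m g)) | c. True}"
  unfolding delay_space_def by (rule obs.span_image_finite) simp

lemma lin_indep_components_iff: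
  assumes "F \<in> S \<rightarrow> S"
  shows "lin_indep_tuple (components S m q (delay_obs S m F g q)) \<longleftrightarrow>
    (\<forall>c. (\<Sum>j<q. obs_scale (c j) ((koopman S m F ^^ j) (ser_obs S m g))) = 0 \<longrightarrow> (\<forall>j<q. c j = 0))"
proof -
  let ?V = "\<lambda>j. (koopman S m F ^^ j) (ser_obs S m g)"
  have "lin_indep_tuple (components S m q (delay_obs S m F g q)) \<longleftrightarrow>
      inj_on ?V {..<q} \<and> obs.independent (?V ` {..<q})"
    by (simp add: lin_indep_tuple_def components_delay_obs[OF assms] delay_lift_def
        inj_on_def image_def)
  also have "\<dots> \<longleftrightarrow> (\<forall>c. (\<Sum>j<q. obs_scale (c j) (?V j)) = 0 \<longrightarrow> (\<forall>j\<in>{..<q}. c j = 0))"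
    by (rule obs.independent_family_iff) simp
  finally show ?thesis by (simp only: Ball_def lessThan_iff)
qed

text \<open>Trades a pointwise vector identity for equations between observables, one per row, to
  which span and independence arguments apply.\<close>

lemma represents_iff:
  assumes "F \<in> S \<rightarrow> S"
  shows "represents S m F g q A \<longleftrightarrow> A \<in> carrier_mat q q \<and>
    (\<forall>i<q. (koopman S m F ^^ Suc i) (ser_obs S m g) =
       (\<Sum>j<q. obs_scale (A $$ (i, j)) ((koopman S m F ^^ j) (ser_obs S m g))))"
    (is "_ \<longleftrightarrow> _ \<and> ?R")
proof (cases "A \<in> carrier_mat q q")
  case A: True
  let ?V = "\<lambda>j. (koopman S m F ^^ j) (ser_obs S m g)"
  have eq: "koopman_delay_obs S m F g q \<sigma> = A *\<^sub>v delay_obs S m F g q \<sigma> \<longleftrightarrow>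
      (\<forall>i<q. ?V (Suc i) \<sigma> = (\<Sum>j<q. A $$ (i, j) * ?V j \<sigma>))" if "\<sigma> \<in> ser_states S m" for \<sigma>
  proof -
    have "(A *\<^sub>v delay_obs S m F g q \<sigma>) $ i = (\<Sum>j<q. A $$ (i, j) * ?V j \<sigma>)" if "i < q" for i
      using A that delay_obs_nth[OF assms \<open>\<sigma> \<in> ser_states S m\<close>, of _ q g]
      by (auto simp: scalar_prod_def lessThan_atLeast0 intro!: sum.cong)
    then show ?thesis
      using A by (auto simp: koopman_delay_obs_eq[OF assms] vec_eq_iff)
  qed
  have "?R \<longleftrightarrow> (\<forall>\<sigma>. \<forall>i<q. ?V (Suc i) \<sigma> = (\<Sum>j<q. A $$ (i, j) * ?V j \<sigma>))"
    by (auto simp: fun_eq_iff sum_obs_scale_apply)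
  also have "\<dots> \<longleftrightarrow> (\<forall>\<sigma>\<in>ser_states S m. \<forall>i<q. ?V (Suc i) \<sigma> = (\<Sum>j<q. A $$ (i, j) * ?V j \<sigma>))"
  \<comment> \<open>Off the serialized states every iterate is 0, so the equations hold trivially
    there.\<close>
  proof -
    have "?V (Suc i) \<sigma> = (\<Sum>j<q. A $$ (i, j) * ?V j \<sigma>)" if "\<sigma> \<notin> ser_states S m" for i \<sigma>
      using koopman_funpow_outside[OF ser_obs_observable that, of _ F g] by (simp del: funpow.simps)
    then show ?thesis by blast
  qed
  finally show ?thesis using A eq by (simp add: represents_def)
qed (simp add: represents_def)

text \<open>Row \<open>i\<close> consists of coefficients of iterate \<open>Suc i\<close>, which
  lies in the delay space as the image of a generator.\<close>

lemma represents_exists: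
  assumes F: "F \<in> S \<rightarrow> S"
    and inv: "koopman S m F ` delay_space S m F g q \<subseteq> delay_space S m F g q"
  shows "\<exists>A. represents S m F g q A"
proof -
  let ?V = "\<lambda>j. (koopman S m F ^^ j) (ser_obs S m g)"
  have "\<exists>c. ?V (Suc i) = (\<Sum>j<q. obs_scale (c j) (?V j))" if "i < q" for i
  proof -
    have "?V i \<in> delay_space S m F g q"
      unfolding delay_space_def using that by (intro obs.span_base) auto
    then have "?V (Suc i) \<in> delay_space S m F g q" using inv by auto
    then show ?thesis by (auto simp: delay_space_eq)
  qed
  \<comment> \<open>The guard \<open>i < q\<close> moves inside the existential so that choice can
    pick a row for every \<open>i\<close>.\<close>
  then have "\<forall>i. \<exists>c. i < q \<longrightarrow> ?V (Suc i) = (\<Sum>j<q. obs_scale (c j) (?V j))" by blast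
  from choice[OF this] obtain a
    where a: "\<forall>i. i < q \<longrightarrow> ?V (Suc i) = (\<Sum>j<q. obs_scale (a i j) (?V j))" ..
  have "represents S m F g q (mat q q (\<lambda>(i, j). a i j))"
    unfolding represents_iff[OF F] using a by (simp del: funpow.simps)
  then show ?thesis ..
qed

text \<open>The difference of corresponding rows gives a linear relation between the components,
  hence vanishes.\<close>

lemma represents_unique:
  assumes F: "F \<in> S \<rightarrow> S"
    and ind: "lin_indep_tuple (components S m q (delay_obs S m F g q))"
    and A: "represents S m F g q A" and B: "represents S m F g q B"
  shows "A = B"
proof (rule eq_matI)
  let ?V = "\<lambda>j. (koopman S m F ^^ j) (ser_obs S m g)"
  fix i j assume "i < dim_row B" "j < dim_col B"
  then have ij: "i < q" "j < q" using B by (auto simp: represents_def)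
  have "(\<Sum>k<q. obs_scale (A $$ (i, k) - B $$ (i, k)) (?V k)) =
      (\<Sum>k<q. obs_scale (A $$ (i, k)) (?V k)) - (\<Sum>k<q. obs_scale (B $$ (i, k)) (?V k))"
    by (simp add: obs.scale_left_diff_distrib sum_subtractf)
  also have "\<dots> = 0" using A B ij by (simp add: represents_iff[OF F])
  finally show "A $$ (i, j) = B $$ (i, j)"
    using ind[unfolded lin_indep_components_iff[OF F], rule_format,
        of "\<lambda>k. A $$ (i, k) - B $$ (i, k)" j] ij by simp
qed (use A B in \<open>auto simp: represents_def\<close>)

text \<open>Adding a nontrivial linear relation between the components to the first row of a
  representing matrix does not change the represented action.\<close>

lemma represents_not_unique:
  assumes F: "F \<in> S \<rightarrow> S"
    and dep: "\<not> lin_indep_tuple (components S m q (delay_obs S m F g q))"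
    and A: "represents S m F g q A"
  shows "\<exists>B. represents S m F g q B \<and> A \<noteq> B"
proof -
  let ?V = "\<lambda>j. (koopman S m F ^^ j) (ser_obs S m g)"
  obtain c k where c: "(\<Sum>j<q. obs_scale (c j) (?V j)) = 0" and k: "k < q" "c k \<noteq> 0"
    using dep unfolding lin_indep_components_iff[OF F] by blast
  define B where "B = mat q q (\<lambda>(i, j). A $$ (i, j) + (if i = 0 then c j else 0))"
  have "(\<Sum>j<q. obs_scale (B $$ (i, j)) (?V j)) = (\<Sum>j<q. obs_scale (A $$ (i, j)) (?V j))"
    if "i < q" for i
    using that c by (cases "i = 0") (simp_all add: B_def obs.scale_left_distrib sum.distrib)
  then have "represents S m F g q B"
    using A unfolding represents_iff[OF F] by (simp add: B_def)
  moreover have "A $$ (0, k) \<noteq> B $$ (0, k)" using k by (simp add: B_def)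
  ultimately show ?thesis by metis
qed

text \<open>The right-hand side is the graph of the Koopman operator on the delay space and does not
  mention \<open>A\<close>: all representing matrices induce the same action. The reason is that
  \<open>A\<close> takes the delay vector at a serialized state to the one at the shifted
  state.\<close>

lemma induced_action_eq:
  assumes F: "F \<in> S \<rightarrow> S" and A: "represents S m F g q A"
  shows "induced_action S m F g q A = {(f, koopman S m F f) | f. f \<in> delay_space S m F g q}"
proof -
  let ?V = "\<lambda>j. (koopman S m F ^^ j) (ser_obs S m g)"
  let ?f = "\<lambda>c. \<Sum>j<q. obs_scale (c j) (?V j)"
  have fst: "on_ser S m (\<lambda>\<sigma>. c \<bullet> delay_obs S m F g q \<sigma>) = ?f (($) c)"
    if "c \<in> carrier_vec q" for c
  proof
    fix \<sigma>
    show "on_ser S m (\<lambda>\<sigma>. c \<bullet> delay_obs S m F g q \<sigma>) \<sigma> = ?f (($) c) \<sigma>"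
    proof (cases "\<sigma> \<in> ser_states S m")
      case True
      then show ?thesis
        using that delay_obs_nth[OF F True, of _ q g]
        by (auto simp: sum_obs_scale_apply on_ser_def scalar_prod_def lessThan_atLeast0
            intro!: sum.cong)
    next
      case False
      then show ?thesis
        by (simp add: sum_obs_scale_apply on_ser_def koopman_funpow_outside[OF ser_obs_observable])
    qed
  qed
  have snd: "on_ser S m (\<lambda>\<sigma>. c \<bullet> (A *\<^sub>v delay_obs S m F g q \<sigma>)) = koopman S m F (?f (($) c))"
    if "c \<in> carrier_vec q" for c
  proof -
    have "on_ser S m (\<lambda>\<sigma>. c \<bullet> (A *\<^sub>v delay_obs S m F g q \<sigma>)) =
        on_ser S m (\<lambda>\<sigma>. c \<bullet> koopman_delay_obs S m F g q \<sigma>)"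
      using A by (auto simp: represents_def on_ser_def fun_eq_iff)
    also have "\<dots> = on_ser S m (\<lambda>\<sigma>. c \<bullet> delay_obs S m F g q (ser_map m F \<sigma>))"
      by (auto simp: on_ser_def fun_eq_iff koopman_delay_obs_eq_delay_obs[OF F])
    also have "\<dots> = koopman S m F (?f (($) c))"
      \<comment> \<open>The shifted state is again a serialized state, so the cutoff in
        \<open>on_ser\<close> has no effect there.\<close>
      unfolding fst[OF that, symmetric]
      by (auto simp: on_ser_def koopman_apply fun_eq_iff ser_map_mem[OF F])
    finally show ?thesis .
  qed
  \<comment> \<open>Only the first \<open>q\<close> coefficients enter, so any coefficient function
    may be replaced by a vector in \<open>carrier_vec q\<close>.\<close>
  have vec: "?f c = ?f (($) (vec q c))" for c by (intro sum.cong) auto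
  have "induced_action S m F g q A =
      {(?f (($) c), koopman S m F (?f (($) c))) | c. c \<in> carrier_vec q}"
    unfolding induced_action_def by (intro Collect_cong ex_cong1) (auto simp: fst snd)
  also have "\<dots> = {(f, koopman S m F f) | f. f \<in> delay_space S m F g q}"
    unfolding delay_space_eq
  proof (intro equalityI subsetI; clarsimp)
    fix c
    show "\<exists>d. ?f c = ?f (($) d) \<and> koopman S m F (?f c) = koopman S m F (?f (($) d))
        \<and> d \<in> carrier_vec q"
      by (rule exI[of _ "vec q c"]) (simp flip: vec)
  qed auto
  finally show ?thesis .
qed

section \<open>Sampled data\<close>

lemma ser_traj_mem:
  assumes "m \<ge> 1" and "\<And>k. 1 \<le> k \<Longrightarrow> k \<le> N \<Longrightarrow> s k \<in> S" and "1 \<le> l" and "l \<le> m * N"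
  shows "ser_traj m s l \<in> ser_states S m"
proof -
  have "(l - 1) div m < N" using assms by (intro less_mult_imp_div_less) (auto simp: mult.commute)
  moreover have "(l - 1) mod m < m" using assms by simp
  ultimately show ?thesis using assms(2) by (auto simp: ser_traj_def ser_states_def)
qed

text \<open>Passing from \<open>l - 1\<close> to \<open>l\<close> either raises the remainder modulo
  \<open>m\<close> or, at the last channel, resets it to 0 and raises the quotient. These are the
  two branches of \<open>ser_map\<close>.\<close>

lemma ser_traj_Suc:
  assumes "m \<ge> 1" and step: "\<And>k. 1 \<le> k \<Longrightarrow> k \<le> N - 1 \<Longrightarrow> s (k + 1) = F (s k)"
    and "1 \<le> l" and "l < m * N"
  shows "ser_traj m s (Suc l) = ser_map m F (ser_traj m s l)"
proof -
  obtain n where n: "l = Suc n" using assms(3) by (cases l) auto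
  show ?thesis
  proof (cases "Suc (n mod m) = m")
    case True
    then have *: "Suc n mod m = 0" "Suc n div m = Suc (n div m)"
      by (auto simp: mod_Suc div_Suc)
    \<comment> \<open>The bound \<open>l < m * N\<close> keeps the next instant at most
      \<open>N\<close>, so \<open>step\<close> applies.\<close>
    have "Suc n div m < N" using assms n by (intro less_mult_imp_div_less) (auto simp: mult.commute)
    then have "s (Suc (Suc (n div m))) = F (s (Suc (n div m)))"
      using step[of "Suc (n div m)"] * by simp
    then show ?thesis using * True n by (simp add: ser_traj_def ser_map_def)
  next
    case False
    moreover have "n mod m < m" using assms by simp
    ultimately have "Suc n mod m = Suc (n mod m)" "Suc n div m = n div m" "Suc (n mod m) < m"
      by (auto simp: mod_Suc div_Suc)
    then show ?thesis using n by (simp add: ser_traj_def ser_map_def)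
  qed
qed

lemma ser_traj_add:
  assumes "m \<ge> 1" and "\<And>k. 1 \<le> k \<Longrightarrow> k \<le> N - 1 \<Longrightarrow> s (k + 1) = F (s k)"
    and "1 \<le> l" and "l + j \<le> m * N"
  shows "(ser_map m F ^^ j) (ser_traj m s l) = ser_traj m s (l + j)"
  using assms(4)
proof (induction j)
  case (Suc j)
  then show ?case using ser_traj_Suc[of m N s F "l + j"] assms by simp
qed simp

text \<open>All blocks have length \<open>m\<close>, so the block and offset of position
  \<open>l - 1\<close> are the quotient and remainder by which \<open>ser_traj\<close> selects state
  and channel.\<close>

lemma ser_record_nth:
  assumes "m \<ge> 1" and g: "g \<in> S \<rightarrow> carrier_vec m"
    and s: "\<And>k. 1 \<le> k \<Longrightarrow> k \<le> N \<Longrightarrow> s k \<in> S"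
    and x: "\<And>k. 1 \<le> k \<Longrightarrow> k \<le> N \<Longrightarrow> x k = g (s k)"
    and "1 \<le> l" and "l \<le> m * N"
  shows "ser_record N x $ (l - 1) = ser_obs S m g (ser_traj m s l)"
proof -
  let ?yss = "map (\<lambda>k. list_of_vec (x k)) [1..<Suc N]"
  have dim: "dim_vec (x k) = m" if "1 \<le> k" "k \<le> N" for k
    using that g s x by (metis PiE carrier_vecD)
  have "length ys = m" if "ys \<in> set ?yss" for ys
    using that dim by (auto simp del: upt_Suc)
  moreover have "l - 1 < m * length ?yss" using assms by (simp del: upt_Suc)
  ultimately have "concat ?yss ! (l - 1) = ?yss ! ((l - 1) div m) ! ((l - 1) mod m)"
    by (rule nth_concat_uniform)
  moreover have lt: "(l - 1) div m < N"
    using assms by (intro less_mult_imp_div_less) (auto simp: mult.commute)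
  ultimately have "ser_record N x $ (l - 1) = g (s (Suc ((l - 1) div m))) $ ((l - 1) mod m)"
    using x by (simp add: ser_record_def vec_of_list_index list_of_vec_index del: upt_Suc)
  moreover have "ser_traj m s l \<in> ser_states S m" by (rule ser_traj_mem) (use assms in auto)
  ultimately show ?thesis by (simp add: ser_obs_def on_ser_def ser_traj_def)
qed

text \<open>The upper bound on \<open>l\<close> keeps the last position \<open>l + q - 1\<close>
  within the \<open>m * N\<close> entries of the record.\<close>

lemma delay_vec_eq_delay_obs:
  assumes "m \<ge> 1" and "g \<in> S \<rightarrow> carrier_vec m"
    and "\<And>k. 1 \<le> k \<Longrightarrow> k \<le> N \<Longrightarrow> s k \<in> S"
    and "\<And>k. 1 \<le> k \<Longrightarrow> k \<le> N - 1 \<Longrightarrow> s (k + 1) = F (s k)"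
    and "\<And>k. 1 \<le> k \<Longrightarrow> k \<le> N \<Longrightarrow> x k = g (s k)"
    and "1 \<le> l" and "l + q \<le> m * N + 1"
  shows "delay_vec N x q l = delay_obs S m F g q (ser_traj m s l)"
proof -
  have "ser_record N x $ (l + j - 1) = ser_obs S m g ((ser_map m F ^^ j) (ser_traj m s l))"
    if "j < q" for j
    using that assms ser_record_nth[of m g S N s x "l + j"] ser_traj_add[of m N s F l j] by simp
  then show ?thesis by (auto simp: delay_vec_def delay_obs_def)
qed

text \<open>Reindexing lets the shifted matrix run over the same column indices as the unshifted
  one.\<close>

lemma hankel_cols_shift:
  "hankel_cols N x q 2 (Suc K) = mat_of_cols q (map (\<lambda>l. delay_vec N x q (Suc l)) [1..<Suc K])"
proof -
  have "[2..<Suc (Suc K)] = map Suc [1..<Suc K]"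
    by (simp add: map_Suc_upt numeral_2_eq_2 del: upt_Suc)
  then show ?thesis by (simp add: hankel_cols_def o_def del: upt_Suc)
qed

text \<open>In the dependent case, non-uniqueness is proved in the sharper form that two distinct
  representing matrices always exist once the delay space is invariant.\<close>

theorem proposition1:
  fixes S :: "'s set" and F :: "'s \<Rightarrow> 's" and g :: "'s \<Rightarrow> 'f::real_normed_field vec"
    and G :: "('s \<times> nat \<Rightarrow> 'f) set"
    and m N q K :: nat and s :: "nat \<Rightarrow> 's" and x :: "nat \<Rightarrow> 'f vec"
  assumes m: "m \<ge> 1" and N: "N \<ge> 1"
    and F: "F \<in> S \<rightarrow> S" and g: "g \<in> S \<rightarrow> carrier_vec m"
    and s_in: "\<And>k. 1 \<le> k \<Longrightarrow> k \<le> N \<Longrightarrow> s k \<in> S"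
    and s_step: "\<And>k. 1 \<le> k \<Longrightarrow> k \<le> N - 1 \<Longrightarrow> s (k + 1) = F (s k)"
    and x: "\<And>k. 1 \<le> k \<Longrightarrow> k \<le> N \<Longrightarrow> x k = g (s k)"
    and q: "1 \<le> q" "q \<le> m * N - 1" and K: "K = m * N - q + 1"
    and G_obs: "G \<subseteq> observables S m"
    and G_lin: "obs.subspace G"
    and G_ser: "ser_obs S m g \<in> G"
    and G_inv: "\<And>f. f \<in> G \<Longrightarrow> on_ser S m (f \<circ> ser_map m F) \<in> G"
  shows
    \<comment> \<open>(1)\<close>
    "(ser_map m F \<in> ser_states S m \<rightarrow> ser_states S m \<and>
      koopman S m F \<in> G \<rightarrow> G \<and>
      (\<forall>f\<in>G. \<forall>\<sigma>\<in>ser_states S m. koopman S m F f \<sigma> = f (ser_map m F \<sigma>)) \<and>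
      (\<forall>f\<in>G. \<forall>f'\<in>G. koopman S m F (f + f') = koopman S m F f + koopman S m F f') \<and>
      (\<forall>c. \<forall>f\<in>G. koopman S m F (obs_scale c f) = obs_scale c (koopman S m F f))) \<and>
    \<comment> \<open>(2)\<close>
     (\<forall>p\<ge>1. \<forall>f\<in>G.
        (\<forall>j<p. delay_lift S m F p f $ j \<in> G) \<and>
        koopman_tuple S m F (delay_lift S m F p f) = delay_lift S m F p (koopman S m F f)) \<and>
    \<comment> \<open>(3)\<close>
     (components S m q (delay_obs S m F g q) = delay_lift S m F q (ser_obs S m g) \<and>
      (\<forall>l\<in>{1..K-1}.
         delay_vec N x q l = delay_obs S m F g q (ser_traj m s l) \<and>
         delay_vec N x q (l + 1) = koopman_delay_obs S m F g q (ser_traj m s l)) \<and>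
      hankel_cols N x q 1 (K - 1) =
        mat_of_cols q (map (\<lambda>l. delay_obs S m F g q (ser_traj m s l)) [1..<K]) \<and>
      hankel_cols N x q 2 K =
        mat_of_cols q (map (\<lambda>l. koopman_delay_obs S m F g q (ser_traj m s l)) [1..<K])) \<and>
    \<comment> \<open>(4)\<close>
     (koopman S m F ` delay_space S m F g q \<subseteq> delay_space S m F g q \<longrightarrow>
        (\<exists>A. represents S m F g q A \<and>
           (\<forall>l\<in>{1..K-1}. delay_vec N x q (l + 1) = A *\<^sub>v delay_vec N x q l) \<and>
           hankel_cols N x q 2 K = A * hankel_cols N x q 1 (K - 1)) \<and>
        (lin_indep_tuple (components S m q (delay_obs S m F g q)) \<longrightarrow>
           (\<exists>!A. represents S m F g q A)) \<and>
        (\<not> lin_indep_tuple (components S m q (delay_obs S m F g q)) \<longrightarrow>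
           (\<exists>A A'. represents S m F g q A \<and> represents S m F g q A' \<and> A \<noteq> A')) \<and>
        (\<forall>A. represents S m F g q A \<longrightarrow>
           induced_action S m F g q A = {(f, koopman S m F f) | f. f \<in> delay_space S m F g q} \<and>
           (\<forall>l\<in>{1..K-1}. delay_vec N x q (l + 1) = A *\<^sub>v delay_vec N x q l) \<and>
           hankel_cols N x q 2 K = A * hankel_cols N x q 1 (K - 1)))"
proof -
  let ?h = "\<lambda>l. delay_obs S m F g q (ser_traj m s l)"
  let ?k = "\<lambda>l. koopman_delay_obs S m F g q (ser_traj m s l)"
  have K2: "K = Suc (K - 1)" using K by simp
  have G_koopman: "koopman S m F f \<in> G" if "f \<in> G" for f
    using G_inv[OF that] by (simp add: koopman_def o_def)
  then have G_funpow: "(koopman S m F ^^ j) f \<in> G" if "f \<in> G" for f j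
    using that by (induction j) auto
  have mem: "ser_traj m s l \<in> ser_states S m" if "l \<in> {1..K-1}" for l
    using that K q by (intro ser_traj_mem[of m N]) (use m s_in in auto)
  \<comment> \<open>In the extreme case \<open>l = K\<close> one has
    \<open>K + q = m * N + 1\<close>: the last delay vector ends at the last record entry.\<close>
  have h: "delay_vec N x q l = ?h l" if "1 \<le> l" "l \<le> K" for l
    using that K q by (intro delay_vec_eq_delay_obs) (use m g s_in s_step x in auto)
  have k: "delay_vec N x q (l + 1) = ?k l" if "l \<in> {1..K-1}" for l
  proof -
    \<comment> \<open>Since \<open>q\<close> is at least 1, \<open>K - 1\<close> is below
      \<open>m * N\<close>, so the serialized trajectory has a next state.\<close>
    have "1 \<le> l" "l < m * N" using that K q by auto
    then have "ser_traj m s (l + 1) = ser_map m F (ser_traj m s l)"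
      using ser_traj_Suc[of m N s F l] m s_step by simp
    then show ?thesis
      using h[of "l + 1"] koopman_delay_obs_eq_delay_obs[OF F mem[OF that], of g q] that K2 by simp
  qed
  have H0: "hankel_cols N x q 1 (K - 1) = mat_of_cols q (map ?h [1..<K])"
  proof -
    have "map (delay_vec N x q) [1..<K] = map ?h [1..<K]" using h by (intro map_cong) auto
    then show ?thesis unfolding hankel_cols_def K2[symmetric] by (rule arg_cong)
  qed
  have H1: "hankel_cols N x q 2 K = mat_of_cols q (map ?k [1..<K])"
  proof -
    have "hankel_cols N x q 2 K = mat_of_cols q (map (\<lambda>l. delay_vec N x q (Suc l)) [1..<K])"
      using hankel_cols_shift[of N x q "K - 1"] unfolding K2[symmetric] .
    also have "map (\<lambda>l. delay_vec N x q (Suc l)) [1..<K] = map ?k [1..<K]"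
      using k by (intro map_cong) auto
    finally show ?thesis .
  qed
  \<comment> \<open>Stated for arbitrary \<open>A\<close>, this serves both the existence claim and
    the claim about all representing matrices.\<close>
  have rep: "(\<forall>l\<in>{1..K-1}. delay_vec N x q (l + 1) = A *\<^sub>v delay_vec N x q l) \<and>
      hankel_cols N x q 2 K = A * hankel_cols N x q 1 (K - 1)"
    if A: "represents S m F g q A" for A
  proof
    have kh: "?k l = A *\<^sub>v ?h l" if "l \<in> {1..K-1}" for l
      using A mem[OF that] by (simp add: represents_def)
    show "\<forall>l\<in>{1..K-1}. delay_vec N x q (l + 1) = A *\<^sub>v delay_vec N x q l"
      using k kh h by auto
    have "A * mat_of_cols q (map ?h [1..<K]) = mat_of_cols q (map ((*\<^sub>v) A) (map ?h [1..<K]))"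
      using A by (intro mult_mat_of_cols) (auto simp: represents_def delay_obs_def)
    also have "map ((*\<^sub>v) A) (map ?h [1..<K]) = map ?k [1..<K]"
      using kh by auto
    finally show "hankel_cols N x q 2 K = A * hankel_cols N x q 1 (K - 1)"
      unfolding H0 H1 ..
  qed
  show ?thesis
  proof (intro conjI impI)
    show "ser_map m F \<in> ser_states S m \<rightarrow> ser_states S m" using ser_map_mem[OF F] by auto
    show "koopman S m F \<in> G \<rightarrow> G" using G_koopman by auto
    show "\<forall>f\<in>G. \<forall>\<sigma>\<in>ser_states S m. koopman S m F f \<sigma> = f (ser_map m F \<sigma>)"
      by (simp add: koopman_apply)
    show "\<forall>f\<in>G. \<forall>f'\<in>G. koopman S m F (f + f') = koopman S m F f + koopman S m F f'"
      by (simp add: koopman_add)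
    show "\<forall>c. \<forall>f\<in>G. koopman S m F (obs_scale c f) = obs_scale c (koopman S m F f)"
      by (simp add: koopman_scale)
    show "\<forall>p\<ge>1. \<forall>f\<in>G. (\<forall>j<p. delay_lift S m F p f $ j \<in> G) \<and>
        koopman_tuple S m F (delay_lift S m F p f) = delay_lift S m F p (koopman S m F f)"
      \<comment> \<open>The first call settles the commutation with \<open>delay_lift\<close> still
        folded; the second unfolds it for membership in \<open>G\<close>.\<close>
      using G_funpow by (simp add: koopman_tuple_delay_lift) (simp add: delay_lift_def)
    show "components S m q (delay_obs S m F g q) = delay_lift S m F q (ser_obs S m g)"
      by (rule components_delay_obs[OF F])
    show "\<forall>l\<in>{1..K-1}. delay_vec N x q l = ?h l \<and> delay_vec N x q (l + 1) = ?k l"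
      using h k by auto
    show "\<forall>A. represents S m F g q A \<longrightarrow>
       induced_action S m F g q A = {(f, koopman S m F f) | f. f \<in> delay_space S m F g q} \<and>
       (\<forall>l\<in>{1..K-1}. delay_vec N x q (l + 1) = A *\<^sub>v delay_vec N x q l) \<and>
       hankel_cols N x q 2 K = A * hankel_cols N x q 1 (K - 1)"
      using rep induced_action_eq[OF F] by blast
  next
    assume inv: "koopman S m F ` delay_space S m F g q \<subseteq> delay_space S m F g q"
    then obtain A where A: "represents S m F g q A" using represents_exists[OF F] by blast
    then show "\<exists>A. represents S m F g q A \<and>
        (\<forall>l\<in>{1..K-1}. delay_vec N x q (l + 1) = A *\<^sub>v delay_vec N x q l) \<and>
        hankel_cols N x q 2 K = A * hankel_cols N x q 1 (K - 1)"
      using rep by blast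
    show "\<exists>!A. represents S m F g q A"
      if "lin_indep_tuple (components S m q (delay_obs S m F g q))"
      using A represents_unique[OF F that] by blast
    show "\<exists>A A'. represents S m F g q A \<and> represents S m F g q A' \<and> A \<noteq> A'"
      if "\<not> lin_indep_tuple (components S m q (delay_obs S m F g q))"
      using A represents_not_unique[OF F that A] by blast
  qed (fact H0 H1)+
qed

end
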